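(* Let $d\ge1$ and $m\ge0$ be integers. Let $\mu$ be a positive real number satisfying $\mu>m$ if $d\ge2$, or $\mu>m+1/2$ if $d=1$. Then, for any nonempty bounded open set $A\subset\mathbb{R}^d$, any compact set $B\subseteq\mathbb{R}^d$, and any positive constants $\gamma,c$, there exists a function $v:\mathbb{R}^d\to\mathbb{R}$ such that $$\operatorname{supp}(v)\subseteq A,\qquad\|v\|_{C^m(\mathbb{R}^d)}\le\gamma,\qquad\|\mathcal{F}v\|_{L^\infty(B)}<1,$$ and $$\|v\|_{L^2(\mathbb{R}^d)}>c\left(\ln\frac{1}{\|\mathcal{F}v\|_{L^\infty(B)}}\right)^{-\mu}.$$
   Context: Fourier transform: $\mathcal{F}v(\xi)=\frac{1}{(2\pi)^d}\int_{\mathbb{R}^d}e^{i\xi x}v(x)\,dx$ for $\xi\in\mathbb{R}^d$, where $\xi x$ is the scalar product. $\|\cdot\|_{C^m(\mathbb{R}^d)}$ is the standard norm on $m$-times continuously differentiable functions (sup norms of derivatives up to order $m$); the bound on $\|v\|_{C^m(\mathbb{R}^d)}$ includes that $v\in C^m(\mathbb{R}^d)$. If $\|\mathcal{F}v\|_{L^\infty(B)}=0$, the quantity $\left(\ln\frac{1}{\|\mathcal{F}v\|_{L^\infty(B)}}\right)^{-\mu}$ is understood as $0$. *)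

theory Defs
  imports "HOL-Analysis.Analysis" "HOL-Probability.Essential_Supremum"
begin

definition partial_deriv :: "'n \<Rightarrow> (real ^ 'n \<Rightarrow> real) \<Rightarrow> real ^ 'n \<Rightarrow> real" where
  "partial_deriv i f x = deriv (\<lambda>t. f (x + t *\<^sub>R axis i 1)) 0"

(* Iterated partial derivatives are indexed by the list of variables that are differentiated;
   on C^m functions the order is irrelevant, so lists of length at most m yield exactly the
   derivatives of multi-index order at most m. *)
definition iter_partial :: "'n list \<Rightarrow> (real ^ 'n \<Rightarrow> real) \<Rightarrow> real ^ 'n \<Rightarrow> real" where
  "iter_partial js f = foldr partial_deriv js f"

primrec Cm_fun :: "nat \<Rightarrow> (real ^ 'n \<Rightarrow> real) \<Rightarrow> bool" where
  "Cm_fun 0 f \<longleftrightarrow> continuous_on UNIV f"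
| "Cm_fun (Suc m) f \<longleftrightarrow> f differentiable_on UNIV \<and> (\<forall>i. Cm_fun m (partial_deriv i f))"

(* Values in ennreal, so that an unbounded derivative yields norm \<infinity>.
   Only meaningful together with Cm_fun, since deriv is unspecified at points of
   non-differentiability. *)
definition Cm_norm :: "nat \<Rightarrow> (real ^ 'n \<Rightarrow> real) \<Rightarrow> ennreal" where
  "Cm_norm m f = (SUP js\<in>{js. length js \<le> m}. SUP x. ennreal \<bar>iter_partial js f x\<bar>)"

definition fourier :: "(real ^ 'n \<Rightarrow> real) \<Rightarrow> real ^ 'n \<Rightarrow> complex" where
  "fourier v \<xi> = complex_of_real (1 / (2 * pi) ^ CARD('n)) *
     (LINT x|lborel. exp (\<i> * complex_of_real (\<xi> \<bullet> x)) * complex_of_real (v x))"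

(* The ess sup is taken in ennreal, whose bottom element is 0: the norm is 0 if B is a null set. *)
definition Linf_norm :: "(real ^ 'n) set \<Rightarrow> (real ^ 'n \<Rightarrow> complex) \<Rightarrow> ennreal" where
  "Linf_norm B f = esssup (lebesgue_on B) (\<lambda>\<xi>. ennreal (cmod (f \<xi>)))"

definition L2_norm :: "(real ^ 'n \<Rightarrow> real) \<Rightarrow> real" where
  "L2_norm v = sqrt (LINT x|lborel. (v x)\<^sup>2)"

definition log_modulus :: "real \<Rightarrow> real \<Rightarrow> real" where
  "log_modulus \<mu> t = (if t = 0 then 0 else ln (1 / t) powr (- \<mu>))"

end

theory Submission
  imports Defs "HOL-Probability.Characteristic_Functions"
begin

text \<open>
The idea is to build \<open>v\<close> from \<open>2 * N\<close> disjoint translates of one bump, of width about \<open>1 / N\<close> in a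
single coordinate direction, with coefficients \<open>h * a j\<close> where \<open>\<bar>a j\<bar> \<le> 1\<close>, and to let \<open>N\<close> tend
to infinity.

Differentiating a bump \<open>m\<close> times costs a factor of order \<open>N ^ m\<close>, and as the supports are disjoint
the sum costs nothing more (\<open>iter_partial_bump_train_le\<close>). The amplitude \<open>h\<close> may hence be
taken of order \<open>N\<close> to the power \<open>- m\<close>.

The Fourier transform of \<open>v\<close> is that of one bump times the exponential sum of the \<open>h * a j\<close> over the
centres (\<open>cmod_fourier_bump_train_le\<close>). If the first \<open>N\<close> power moments of the \<open>a j\<close> with respect to
the positions of the centres vanish, only a Taylor remainder of order \<open>N\<close> survives, and on the compact
set \<open>B\<close> this is of the size \<open>N * Q ^ N / fact N\<close>
(\<open>exp_sum_bound_of_vanishing_moments\<close>), eventually below \<open>exp (- N)\<close>. The logarithmic modulus of its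
norm on \<open>B\<close> is then at most \<open>N powr (- \<mu>)\<close>.

It remains to keep the norm of \<open>v\<close> in \<open>L\<^sup>2\<close> of the same order as the amplitude \<open>h\<close>. The moment
conditions are only \<open>N\<close> linear equations for \<open>2 * N\<close> coefficients, so a solution in the unit cube can
be chosen of which at least \<open>N\<close> coefficients have absolute value \<open>1\<close>
(\<open>bounded_solution_mostly_saturated\<close>). The corresponding bumps fill a volume bounded below, and the
norm is at least a constant times \<open>N\<close> to the power \<open>- m\<close>. Since \<open>m < \<mu>\<close>, this beats
\<open>c * N powr (- \<mu>)\<close> for large \<open>N\<close>.
\<close>

section \<open>Bounded coefficients with many vanishing linear functionals\<close>

lemma homogeneous_system_nontrivial_solution:
  fixes f :: "nat \<Rightarrow> 'a \<Rightarrow> real"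
  assumes "finite J" and "K < card J"
  shows "\<exists>b. (\<exists>j\<in>J. b j \<noteq> 0) \<and> (\<forall>k<K. (\<Sum>j\<in>J. b j * f k j) = 0)"
  using assms
proof (induction K arbitrary: J f)
  case 0
  then obtain j where "j \<in> J" by fastforce
  then show ?case by (intro exI[of _ "\<lambda>_. 1"]) auto
next
  case (Suc K)
  show ?case
  proof (cases "\<exists>p\<in>J. f K p \<noteq> 0")
    case False
    obtain b where "\<exists>j\<in>J. b j \<noteq> 0" and b: "\<forall>k<K. (\<Sum>j\<in>J. b j * f k j) = 0"
      using Suc.IH[of J f] Suc.prems by auto
    moreover have "(\<Sum>j\<in>J. b j * f k j) = 0" if "k < Suc K" for k
      using that b False by (cases "k = K") auto
    ultimately show ?thesis by blast
  next
    case True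
    then obtain p where p: "p \<in> J" "f K p \<noteq> 0" by blast
    define J' where "J' = J - {p}"
    \<comment> \<open>Equation \<open>K\<close> is used to eliminate the unknown \<open>b p\<close> from the others.\<close>
    define g where "g k j = f k j - f k p * f K j / f K p" for k j
    have J: "J = insert p J'" "p \<notin> J'" "finite J'" "K < card J'"
      using p Suc.prems by (auto simp: J'_def)
    obtain b j where b: "j \<in> J'" "b j \<noteq> 0" "\<And>k. k < K \<Longrightarrow> (\<Sum>j\<in>J'. b j * g k j) = 0"
      using Suc.IH[of J' g] J by blast
    define b' where "b' = b(p := - (\<Sum>j\<in>J'. b j * f K j) / f K p)"
    have split: "(\<Sum>j\<in>J. b' j * f k j) = (\<Sum>j\<in>J'. b j * g k j)" for k
    proof -
      have "(\<Sum>j\<in>J'. b' j * f k j) = (\<Sum>j\<in>J'. b j * f k j)"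
        using J by (intro sum.cong) (auto simp: b'_def)
      then have "(\<Sum>j\<in>J. b' j * f k j)
          = (\<Sum>j\<in>J'. b j * f k j) - (f k p / f K p) * (\<Sum>j\<in>J'. b j * f K j)"
        using J by (simp add: b'_def)
      also have "\<dots> = (\<Sum>j\<in>J'. b j * g k j)"
        by (simp add: g_def sum_distrib_left sum_subtractf[symmetric] algebra_simps)
      finally show ?thesis .
    qed
    have "g K j = 0" for j
      using p by (simp add: g_def)
    then have "(\<Sum>j\<in>J. b' j * f k j) = 0" if "k < Suc K" for k
      using that b(3) split by (cases "k = K") auto
    moreover have "b' j \<noteq> 0" "j \<in> J"
      using b J by (auto simp: b'_def)
    ultimately show ?thesis by blast
  qed
qed

text \<open>This is the extreme point principle for the polytope of vectors in the unit cube that are annihilated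
by \<open>K\<close> functionals: at a vertex all but at most \<open>K\<close> coordinates lie on the boundary of the cube.
Instead of a vertex, the proof takes a feasible vector with the largest number of saturated
coordinates. If more than \<open>K\<close> coordinates were free, some nonzero null vector would be supported on
them, and moving along it until the first free coordinate hits the boundary would saturate one more.
For the theorem the point is that the vanishing conditions cost only a constant factor in the
\<open>\<ell>\<^sup>2\<close> norm, whereas an explicit solution such as an alternating row of binomial coefficients is
concentrated on few coordinates.\<close>

lemma bounded_solution_mostly_saturated:
  fixes f :: "nat \<Rightarrow> 'a \<Rightarrow> real"
  assumes "finite J"
  shows "\<exists>a. (\<forall>j\<in>J. \<bar>a j\<bar> \<le> 1) \<and> (\<forall>k<K. (\<Sum>j\<in>J. a j * f k j) = 0) \<and>
           card J \<le> card {j\<in>J. \<bar>a j\<bar> = 1} + K"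
proof -
  define P where "P a \<longleftrightarrow> (\<forall>j\<in>J. \<bar>a j\<bar> \<le> 1) \<and> (\<forall>k<K. (\<Sum>j\<in>J. a j * f k j) = 0)"
    for a :: "'a \<Rightarrow> real"
  have "P (\<lambda>_. 0)" by (simp add: P_def)
  moreover have "\<forall>a. P a \<longrightarrow> card {j\<in>J. \<bar>a j\<bar> = 1} < Suc (card J)"
    using assms by (auto simp: less_Suc_eq_le intro: card_mono)
  ultimately obtain a where a: "P a"
    and max: "\<And>a'. P a' \<Longrightarrow> card {j\<in>J. \<bar>a' j\<bar> = 1} \<le> card {j\<in>J. \<bar>a j\<bar> = 1}"
    using ex_has_greatest_nat[of P "\<lambda>_. 0" "\<lambda>a. card {j\<in>J. \<bar>a j\<bar> = 1}"] by blast
  define F where "F = {j\<in>J. \<bar>a j\<bar> < 1}"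
  have "finite F" using assms by (simp add: F_def)
  have "J = F \<union> {j\<in>J. \<bar>a j\<bar> = 1}"
    using a by (auto simp: P_def F_def order_less_le)
  then have cardJ: "card J \<le> card F + card {j\<in>J. \<bar>a j\<bar> = 1}"
    by (metis (no_types, lifting) card_Un_le)
  have "card F \<le> K"
  proof (rule ccontr)
    assume "\<not> card F \<le> K"
    then obtain b where b0: "\<exists>j\<in>F. b j \<noteq> 0" and b: "\<forall>k<K. (\<Sum>j\<in>F. b j * f k j) = 0"
      using homogeneous_system_nontrivial_solution[OF \<open>finite F\<close>, of K f] by auto
    define F' where "F' = {j\<in>F. b j \<noteq> 0}"
    have F': "finite F'" "F' \<noteq> {}"
      using \<open>finite F\<close> b0 by (auto simp: F'_def)
    \<comment> \<open>\<open>\<tau> j\<close> is the time at which coordinate \<open>j\<close>, moving with speed \<open>b j\<close>, reaches the boundary.\<close>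
    define \<tau> where "\<tau> j = (1 - sgn (b j) * a j) / \<bar>b j\<bar>" for j
    define t where "t = Min (\<tau> ` F')"
    have "t \<in> \<tau> ` F'"
      unfolding t_def using F' by (intro Min_in) auto
    then obtain j0 where j0: "j0 \<in> F'" "t = \<tau> j0" by blast
    have \<tau>_pos: "0 < \<tau> j" if "j \<in> F'" for j
      using that by (auto simp: \<tau>_def F'_def F_def sgn_if abs_less_iff)
    have t_le: "t \<le> \<tau> j" if "j \<in> F'" for j
      using that F' by (auto simp: t_def)
    define a' where "a' j = a j + t * (if j \<in> F then b j else 0)" for j
    have feasible: "\<bar>a' j\<bar> \<le> 1" if "j \<in> J" for j
    proof (cases "j \<in> F'")
      case True
      have "t * \<bar>b j\<bar> \<le> 1 - sgn (b j) * a j" "0 \<le> t * \<bar>b j\<bar>"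
        using t_le[OF True] \<tau>_pos[OF j0(1)] j0(2) True
        by (auto simp: \<tau>_def F'_def field_simps)
      then show ?thesis
        using True a that by (auto simp: a'_def F'_def F_def sgn_if abs_le_iff split: if_splits)
    next
      case False
      then show ?thesis
        using a that by (auto simp: a'_def F'_def P_def)
    qed
    have "t * \<bar>b j0\<bar> = 1 - sgn (b j0) * a j0"
      using j0 by (simp add: \<tau>_def F'_def)
    then have tight: "\<bar>a' j0\<bar> = 1"
      using j0 by (auto simp: a'_def F'_def sgn_if split: if_splits)
    have "(\<Sum>j\<in>J. a' j * f k j) = 0" if "k < K" for k
    proof -
      have "(\<Sum>j\<in>J. a' j * f k j)
          = (\<Sum>j\<in>J. a j * f k j) + t * (\<Sum>j\<in>J. if j \<in> F then b j * f k j else 0)"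
        unfolding sum_distrib_left sum.distrib[symmetric]
        by (intro sum.cong) (auto simp: a'_def algebra_simps)
      also have "(\<Sum>j\<in>J. if j \<in> F then b j * f k j else 0) = (\<Sum>j\<in>F. b j * f k j)"
        using assms by (subst sum.inter_filter[symmetric]) (auto simp: F_def intro: sum.cong)
      finally show ?thesis
        using a b that by (simp add: P_def)
    qed
    then have "P a'"
      using feasible by (simp add: P_def)
    moreover have "{j\<in>J. \<bar>a j\<bar> = 1} \<subset> {j\<in>J. \<bar>a' j\<bar> = 1}"
    proof
      show "{j\<in>J. \<bar>a j\<bar> = 1} \<subseteq> {j\<in>J. \<bar>a' j\<bar> = 1}"
        by (auto simp: a'_def F_def)
      show "{j\<in>J. \<bar>a j\<bar> = 1} \<noteq> {j\<in>J. \<bar>a' j\<bar> = 1}"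
      proof -
        have "j0 \<in> {j\<in>J. \<bar>a' j\<bar> = 1}" "j0 \<notin> {j\<in>J. \<bar>a j\<bar> = 1}"
          using tight j0(1) by (auto simp: F'_def F_def)
        then show ?thesis by blast
      qed
    qed
    then have "card {j\<in>J. \<bar>a j\<bar> = 1} < card {j\<in>J. \<bar>a' j\<bar> = 1}"
      using assms by (intro psubset_card_mono) auto
    ultimately show False
      using max[of a'] by simp
  qed
  then show ?thesis
    using a cardJ by (intro exI[of _ a]) (auto simp: P_def)
qed

text \<open>The coefficients annihilate the Taylor polynomial of degree \<open>K - 1\<close> of each exponential, so that
only the Taylor remainders contribute.\<close>

lemma exp_sum_bound_of_vanishing_moments:
  fixes a s :: "'a \<Rightarrow> real"
  assumes moments: "\<And>k. k < K \<Longrightarrow> (\<Sum>j\<in>J. a j * s j ^ k) = 0"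
    and "0 < K"
    and a: "\<And>j. j \<in> J \<Longrightarrow> \<bar>a j\<bar> \<le> 1"
    and s: "\<And>j. j \<in> J \<Longrightarrow> \<bar>t * s j\<bar> \<le> r"
  shows "cmod (\<Sum>j\<in>J. of_real (a j) * iexp (t * s j)) \<le> real (card J) * (r ^ K / fact K)"
proof -
  obtain n where K: "K = Suc n" using \<open>0 < K\<close> by (cases K) auto
  define T where "T x = (\<Sum>k\<le>n. (\<i> * complex_of_real x) ^ k / fact k)" for x
  have "(\<Sum>j\<in>J. of_real (a j) * T (t * s j))
      = (\<Sum>k\<le>n. (\<i> * of_real t) ^ k / fact k * of_real (\<Sum>j\<in>J. a j * s j ^ k))"
    unfolding T_def sum_distrib_left of_real_sum
    by (subst sum.swap) (simp add: power_mult_distrib algebra_simps)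
  also have "\<dots> = 0"
    using moments by (intro sum.neutral) (auto simp: K)
  finally have "(\<Sum>j\<in>J. of_real (a j) * iexp (t * s j))
      = (\<Sum>j\<in>J. of_real (a j) * (iexp (t * s j) - T (t * s j)))"
    by (simp add: algebra_simps sum_subtractf)
  also have "cmod \<dots> \<le> (\<Sum>j\<in>J. r ^ K / fact K)"
  proof (rule sum_norm_le)
    fix j assume j: "j \<in> J"
    have "cmod (iexp (t * s j) - T (t * s j)) \<le> \<bar>t * s j\<bar> ^ K / fact K"
      unfolding T_def K by (rule iexp_approx1)
    also have "\<dots> \<le> r ^ K / fact K"
      using s[OF j] by (intro divide_right_mono power_mono) auto
    finally show "cmod (of_real (a j) * (iexp (t * s j) - T (t * s j))) \<le> r ^ K / fact K"
      using mult_mono[OF a[OF j], of "cmod (iexp (t * s j) - T (t * s j))" "r ^ K / fact K"]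
      by (simp add: norm_mult)
  qed
  finally show ?thesis by simp
qed

lemma eventually_power_over_fact_le_exp:
  fixes C Q :: real
  assumes "0 \<le> C" "0 \<le> Q"
  shows "eventually (\<lambda>K. C * real K * (Q ^ K / fact K) \<le> exp (- real K)) sequentially"
proof -
  define q where "q = 2 * Q * exp 1"
  have "(\<lambda>K. C * (q ^ K / fact K)) \<longlonglongrightarrow> C * 0"
    using summable_LIMSEQ_zero[OF summable_exp[of q]]
    by (intro tendsto_mult_left) (simp add: divide_inverse mult.commute)
  then have "eventually (\<lambda>K. C * (q ^ K / fact K) < 1) sequentially"
    by (auto dest: order_tendstoD(2)[where a = 1])
  then show ?thesis
  proof eventually_elim
    case (elim K)
    \<comment> \<open>The linear factor is absorbed by doubling the base, as \<open>K \<le> 2 ^ K\<close>.\<close>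
    have "C * real K * (Q ^ K / fact K) * exp (real K)
        = C * real K * ((Q * exp 1) ^ K / fact K)"
      by (simp add: power_mult_distrib exp_of_nat_mult[symmetric])
    also have "\<dots> \<le> C * 2 ^ K * ((Q * exp 1) ^ K / fact K)"
      using assms of_nat_less_two_power[of K, where 'a = real]
      by (intro mult_mono mult_left_mono) auto
    also have "\<dots> = C * (q ^ K / fact K)"
      by (simp add: q_def power_mult_distrib)
    finally show ?case
      using elim by (simp add: exp_minus field_simps)
  qed
qed

section \<open>Calculus of iterated partial derivatives\<close>

lemma partial_deriv_has_derivative:
  assumes "(f has_derivative f') (at x)"
  shows "partial_deriv i f x = f' (axis i 1)"
proof -
  interpret f': bounded_linear f' using assms by (rule has_derivative_bounded_linear)
  have "(f \<circ> (\<lambda>t. x + t *\<^sub>R axis i 1) has_derivative f' \<circ> (\<lambda>t. t *\<^sub>R axis i 1)) (at 0)"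
    using assms by (intro diff_chain_at) (auto intro!: derivative_eq_intros)
  then have "((\<lambda>t. f (x + t *\<^sub>R axis i 1)) has_field_derivative f' (axis i 1)) (at 0)"
    by (simp add: has_field_derivative_def o_def f'.scaleR mult_commute_abs)
  then show ?thesis
    unfolding partial_deriv_def by (rule DERIV_imp_deriv)
qed

lemma partial_deriv_sum:
  assumes "\<And>j. j \<in> J \<Longrightarrow> f j differentiable (at x)"
  shows "partial_deriv i (\<lambda>x. \<Sum>j\<in>J. a j * f j x) x = (\<Sum>j\<in>J. a j * partial_deriv i (f j) x)"
proof -
  define f' where "f' j = (SOME D. (f j has_derivative D) (at x))" for j
  have f': "(f j has_derivative f' j) (at x)" if "j \<in> J" for j
    using assms[OF that] unfolding f'_def differentiable_def by (rule someI_ex)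
  have "((\<lambda>x. \<Sum>j\<in>J. a j * f j x) has_derivative (\<lambda>h. \<Sum>j\<in>J. a j * f' j h)) (at x)"
    by (intro has_derivative_sum has_derivative_mult_right f')
  then show ?thesis
    using partial_deriv_has_derivative[OF f'] by (simp add: partial_deriv_has_derivative)
qed

lemma partial_deriv_translate: "partial_deriv i (\<lambda>x. f (x - p)) x = partial_deriv i f (x - p)"
  by (simp add: partial_deriv_def algebra_simps)

lemma partial_deriv_local:
  assumes "open U" "x \<in> U" "\<And>y. y \<in> U \<Longrightarrow> f y = 0"
  shows "partial_deriv i f x = 0"
proof -
  have "((\<lambda>_. 0) has_derivative (\<lambda>_. 0)) (at x)" by simp
  then have "(f has_derivative (\<lambda>_. 0)) (at x)"
    by (rule has_derivative_transform_within_open[OF _ assms(1,2)]) (simp add: assms(3))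
  then show ?thesis by (simp add: partial_deriv_has_derivative)
qed

lemma Cm_fun_differentiable: "Cm_fun (Suc m) f \<Longrightarrow> f differentiable (at x)"
  by (simp add: differentiable_on_eq_differentiable_at)

lemma Cm_fun_continuous: "Cm_fun m f \<Longrightarrow> continuous_on UNIV f"
  by (cases m) (auto intro: differentiable_imp_continuous_on)

lemma Cm_fun_sum:
  assumes "\<And>j. j \<in> J \<Longrightarrow> Cm_fun m (f j)"
  shows "Cm_fun m (\<lambda>x. \<Sum>j\<in>J. a j * f j x)"
  using assms
proof (induction m arbitrary: f)
  case 0
  then show ?case by (auto intro!: continuous_intros)
next
  case (Suc m)
  have d: "f j differentiable (at x)" if "j \<in> J" for j x
    using Suc.prems[OF that] by (rule Cm_fun_differentiable)
  have "partial_deriv i (\<lambda>x. \<Sum>j\<in>J. a j * f j x) = (\<lambda>x. \<Sum>j\<in>J. a j * partial_deriv i (f j) x)" for i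
    using d by (intro ext partial_deriv_sum)
  moreover have "Cm_fun m (\<lambda>x. \<Sum>j\<in>J. a j * partial_deriv i (f j) x)" for i
    using Suc.prems by (intro Suc.IH) auto
  moreover have "(\<lambda>x. \<Sum>j\<in>J. a j * f j x) differentiable_on UNIV"
  proof (cases "finite J")
    case True
    then show ?thesis
      using d by (auto simp: differentiable_on_eq_differentiable_at
          intro!: differentiable_sum differentiable_mult)
  qed auto
  ultimately show ?case by simp
qed

lemma iter_partial_Nil [simp]: "iter_partial [] f = f"
  by (simp add: iter_partial_def)

lemma iter_partial_Cons [simp]: "iter_partial (i # js) f = partial_deriv i (iter_partial js f)"
  by (simp add: iter_partial_def)

text \<open>While \<open>iter_partial\<close> applies the head of the list last, \<open>Cm_fun\<close> peels off the derivative that is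
taken first. The induction that connects the two therefore runs over lists from the right.\<close>

lemma iter_partial_snoc: "iter_partial (js @ [i]) f = iter_partial js (partial_deriv i f)"
  by (simp add: iter_partial_def)

lemma Cm_fun_iter_partial:
  assumes "Cm_fun m f" "length js \<le> m"
  shows "Cm_fun (m - length js) (iter_partial js f)"
  using assms
proof (induction js arbitrary: f m rule: rev_induct)
  case (snoc i js)
  then obtain m' where "m = Suc m'" by (cases m) auto
  with snoc show ?case by (simp add: iter_partial_snoc)
qed simp

lemma iter_partial_sum:
  assumes "\<And>j. j \<in> J \<Longrightarrow> Cm_fun m (f j)" "length js \<le> m"
  shows "iter_partial js (\<lambda>x. \<Sum>j\<in>J. a j * f j x) = (\<lambda>x. \<Sum>j\<in>J. a j * iter_partial js (f j) x)"
  using assms(2)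
proof (induction js)
  case (Cons i js)
  have "Suc (m - Suc (length js)) = m - length js" using Cons.prems by simp
  then have "iter_partial js (f j) differentiable (at x)" if "j \<in> J" for j x
    using Cm_fun_iter_partial[OF assms(1)[OF that], of js] Cons.prems
    by (metis Cm_fun_differentiable Suc_leD length_Cons)
  then show ?case
    using Cons by (auto intro!: partial_deriv_sum)
qed simp

lemma iter_partial_translate:
  "iter_partial js (\<lambda>x. f (x - p)) = (\<lambda>x. iter_partial js f (x - p))"
  by (induction js) (auto simp: partial_deriv_translate)

lemma Cm_fun_translate: "Cm_fun m f \<Longrightarrow> Cm_fun m (\<lambda>x. f (x - p))"
proof (induction m arbitrary: f)
  case 0
  then show ?case
    by (auto intro!: continuous_on_compose2[of UNIV f] continuous_intros)
next
  case (Suc m)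
  have "(\<lambda>x. f (x - p)) differentiable (at x)" for x
    using differentiable_chain_at[of "\<lambda>x. x - p" x f] Cm_fun_differentiable[OF Suc.prems]
    by (auto simp: o_def)
  moreover have "partial_deriv i (\<lambda>x. f (x - p)) = (\<lambda>x. partial_deriv i f (x - p))" for i
    by (simp add: partial_deriv_translate fun_eq_iff)
  ultimately show ?case
    using Suc by (simp add: differentiable_on_eq_differentiable_at)
qed

lemma iter_partial_support:
  assumes "closed S" "\<And>x. x \<notin> S \<Longrightarrow> f x = 0" "x \<notin> S"
  shows "iter_partial js f x = 0"
  using assms(3)
proof (induction js arbitrary: x)
  case (Cons i js)
  then show ?case
    using partial_deriv_local[of "- S" x "iter_partial js f"] assms(1) by auto
qed (use assms in auto)

text \<open>The bumps of the construction are thin in one direction \<open>e\<close> only. Then \<open>N\<close> of them in a row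
occupy a volume bounded below, while each derivative costs at most a factor \<open>l * N\<close>.\<close>

definition stretch :: "'n \<Rightarrow> real \<Rightarrow> real \<Rightarrow> real ^ 'n \<Rightarrow> real ^ 'n" where
  "stretch e N l x = (\<chi> i. l * (if i = e then N else 1) * x $ i)"

lemma stretch_component: "stretch e N l x $ i = l * (if i = e then N else 1) * x $ i"
  by (simp add: stretch_def)

lemma linear_stretch: "linear (stretch e N l)"
  by (rule linearI) (auto simp: stretch_def vec_eq_iff algebra_simps)

lemma continuous_on_stretch [continuous_intros]:
  "continuous_on S f \<Longrightarrow> continuous_on S (\<lambda>x. stretch e N l (f x))"
  unfolding stretch_def by (intro continuous_intros)

lemma norm_le_norm_stretch:
  assumes "1 \<le> N" "0 \<le> l"
  shows "l * norm x \<le> norm (stretch e N l x)"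
proof -
  have "norm (l *\<^sub>R x) \<le> norm (stretch e N l x)"
  proof (rule norm_le_componentwise_cart)
    fix i
    show "norm ((l *\<^sub>R x) $ i) \<le> norm (stretch e N l x $ i)"
      using assms mult_right_mono[of 1 N "l * \<bar>x $ i\<bar>"]
      by (auto simp: stretch_def abs_mult mult_ac)
  qed
  then show ?thesis using assms by simp
qed

lemma partial_deriv_stretch:
  assumes "f differentiable (at (stretch e N l x))"
  shows "partial_deriv i (\<lambda>x. f (stretch e N l x)) x
    = l * (if i = e then N else 1) * partial_deriv i f (stretch e N l x)"
proof -
  obtain D where D: "(f has_derivative D) (at (stretch e N l x))"
    using assms by (auto simp: differentiable_def)
  interpret D: bounded_linear D using D by (rule has_derivative_bounded_linear)
  have "(stretch e N l has_derivative stretch e N l) (at x)"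
    by (rule linear_imp_has_derivative[OF linear_stretch])
  from diff_chain_at[OF this D]
  have "((\<lambda>x. f (stretch e N l x)) has_derivative (\<lambda>h. D (stretch e N l h))) (at x)"
    by (simp add: o_def)
  moreover have "stretch e N l (axis i 1) = (l * (if i = e then N else 1)) *\<^sub>R axis i 1"
    by (auto simp: stretch_def vec_eq_iff axis_def)
  ultimately show ?thesis
    by (simp add: partial_deriv_has_derivative[OF D] partial_deriv_has_derivative D.scaleR)
qed

lemma differentiable_stretch:
  assumes "\<And>x. f differentiable (at x)"
  shows "(\<lambda>x. f (stretch e N l x)) differentiable (at x)"
  using differentiable_chain_at[OF linear_imp_differentiable[OF linear_stretch], of f e N l x] assms
  by (simp add: o_def)

lemma Cm_fun_stretch: "Cm_fun m f \<Longrightarrow> Cm_fun m (\<lambda>x. f (stretch e N l x))"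
proof (induction m arbitrary: f)
  case 0
  then show ?case
    by (auto intro!: continuous_on_compose2[of UNIV f] continuous_intros)
next
  case (Suc m)
  note d = Cm_fun_differentiable[OF Suc.prems]
  \<comment> \<open>The constant factor appears as a sum with one term, to which \<open>Cm_fun_sum\<close> applies.\<close>
  have "partial_deriv i (\<lambda>x. f (stretch e N l x))
      = (\<lambda>x. \<Sum>j\<in>{()}. (l * (if i = e then N else 1)) * partial_deriv i f (stretch e N l x))" for i
    using partial_deriv_stretch[OF d] by auto
  moreover have "Cm_fun m
      (\<lambda>x. \<Sum>j\<in>{()}. (l * (if i = e then N else 1)) * partial_deriv i f (stretch e N l x))" for i
    using Suc by (intro Cm_fun_sum) auto
  ultimately show ?case
    using differentiable_stretch[OF d] by (simp add: differentiable_on_eq_differentiable_at)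
qed

lemma iter_partial_stretch:
  assumes "Cm_fun m f" "length js \<le> m"
  shows "iter_partial js (\<lambda>x. f (stretch e N l x))
    = (\<lambda>x. (\<Prod>i\<leftarrow>js. l * (if i = e then N else 1)) * iter_partial js f (stretch e N l x))"
  using assms(2)
proof (induction js)
  case (Cons i js)
  have "Suc (m - Suc (length js)) = m - length js" using Cons.prems by simp
  then have d: "iter_partial js f differentiable (at x)" for x
    using Cm_fun_iter_partial[OF assms(1), of js] Cons.prems
    by (metis Cm_fun_differentiable Suc_leD length_Cons)
  have "partial_deriv i (\<lambda>x. (\<Prod>i\<leftarrow>js. l * (if i = e then N else 1))
        * iter_partial js f (stretch e N l x)) x
      = (\<Prod>i\<leftarrow>js. l * (if i = e then N else 1))
        * partial_deriv i (\<lambda>x. iter_partial js f (stretch e N l x)) x" for x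
    using partial_deriv_sum[of "{()}" "\<lambda>_ x. iter_partial js f (stretch e N l x)" x i
        "\<lambda>_. \<Prod>i\<leftarrow>js. l * (if i = e then N else 1)"] differentiable_stretch[OF d] by simp
  moreover have "iter_partial js (\<lambda>x. f (stretch e N l x))
      = (\<lambda>x. (\<Prod>i\<leftarrow>js. l * (if i = e then N else 1)) * iter_partial js f (stretch e N l x))"
    using Cons by simp
  ultimately show ?case
    using partial_deriv_stretch[OF d, of i] by (simp add: mult_ac)
qed simp

lemma abs_iter_partial_stretch_le:
  assumes "Cm_fun m f" "length js \<le> m" "1 \<le> N" "1 \<le> l" "\<And>x. \<bar>iter_partial js f x\<bar> \<le> C"
  shows "\<bar>iter_partial js (\<lambda>x. f (stretch e N l x)) x\<bar> \<le> (l * N) ^ m * C"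
proof -
  have "\<bar>\<Prod>i\<leftarrow>js. l * (if i = e then N else 1)\<bar> \<le> (l * N) ^ length js"
  proof (induction js)
    case (Cons i js)
    have "\<bar>l * (if i = e then N else 1)\<bar> \<le> l * N"
      using assms(3,4) by (auto simp: abs_mult)
    then have "\<bar>l * (if i = e then N else 1)\<bar> * \<bar>\<Prod>i\<leftarrow>js. l * (if i = e then N else 1)\<bar>
        \<le> (l * N) * (l * N) ^ length js"
      using Cons assms(3,4) by (intro mult_mono) auto
    then show ?case by (simp only: abs_mult list.map prod_list.Cons length_Cons power_Suc)
  qed simp
  also have "\<dots> \<le> (l * N) ^ m"
    using assms(2-4) by (intro power_increasing) (auto simp: mult_ge1_I)
  finally show ?thesis
    using assms by (auto simp: iter_partial_stretch[OF assms(1,2)] abs_mult intro!: mult_mono)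
qed

section \<open>A bump of class \<open>C\<^sup>m\<close>\<close>

lemma real_polynomial_function_partial_deriv:
  "real_polynomial_function p \<Longrightarrow> real_polynomial_function (partial_deriv i p)"
proof (induction p rule: real_polynomial_function.induct)
  case (linear f)
  then have "partial_deriv i f = (\<lambda>_. f (axis i 1))"
    using partial_deriv_has_derivative bounded_linear_imp_has_derivative by blast
  then show ?case by auto
next
  case (const c)
  have "partial_deriv i (\<lambda>_. c) = (\<lambda>_. 0)"
    by (auto simp: partial_deriv_def)
  then show ?case by auto
next
  case (add f g)
  have D: "(f has_derivative frechet_derivative f (at x)) (at x)"
      "(g has_derivative frechet_derivative g (at x)) (at x)" for x
    using add differentiable_at_real_polynomial_function frechet_derivative_works by blast+
  have "partial_deriv i (\<lambda>x. f x + g x) = (\<lambda>x. partial_deriv i f x + partial_deriv i g x)"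
    by (simp add: fun_eq_iff partial_deriv_has_derivative[OF has_derivative_add[OF D]]
        partial_deriv_has_derivative[OF D(1)] partial_deriv_has_derivative[OF D(2)])
  then show ?case using add by auto
next
  case (mult f g)
  have D: "(f has_derivative frechet_derivative f (at x)) (at x)"
      "(g has_derivative frechet_derivative g (at x)) (at x)" for x
    using mult differentiable_at_real_polynomial_function frechet_derivative_works by blast+
  have "partial_deriv i (\<lambda>x. f x * g x) = (\<lambda>x. f x * partial_deriv i g x + partial_deriv i f x * g x)"
    by (simp add: fun_eq_iff partial_deriv_has_derivative[OF has_derivative_mult[OF D]]
        partial_deriv_has_derivative[OF D(1)] partial_deriv_has_derivative[OF D(2)])
  then show ?case using mult by auto
qed

lemma real_polynomial_function_inner_self: "real_polynomial_function (\<lambda>x::real^'n. x \<bullet> x)"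
proof -
  have "real_polynomial_function (\<lambda>x::real^'n. \<Sum>i\<in>UNIV. x $ i * x $ i)"
    by (intro real_polynomial_function_sum real_polynomial_function.intros bounded_linear_vec_nth) auto
  then show ?thesis by (simp add: inner_vec_def)
qed

lemma DERIV_pos_part_power:
  "((\<lambda>t::real. max 0 t ^ Suc (Suc n)) has_field_derivative real (Suc (Suc n)) * max 0 t ^ Suc n) (at t)"
proof -
  consider "t < 0" | "t = 0" | "t > 0" by linarith
  then show ?thesis
  proof cases
    case 1
    have "((\<lambda>_. 0) has_field_derivative real (Suc (Suc n)) * max 0 t ^ Suc n) (at t)"
      using 1 by (auto intro!: derivative_eq_intros)
    then show ?thesis
      by (rule has_field_derivative_transform_within_open[of _ _ _ "{..<0}"]) (use 1 in auto)
  next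
    case 3
    have "((\<lambda>t. t ^ Suc (Suc n)) has_field_derivative real (Suc (Suc n)) * max 0 t ^ Suc n) (at t)"
      using 3 DERIV_pow[of "Suc (Suc n)" t] by (simp add: max_def)
    then show ?thesis
      by (rule has_field_derivative_transform_within_open[of _ _ _ "{0<..}"]) (use 3 in auto)
  next
    case 2
    have "((\<lambda>h. max 0 h ^ Suc n) \<longlongrightarrow> 0) (at (0::real))"
      by (auto intro!: tendsto_eq_intros)
    then have "((\<lambda>h::real. max 0 h ^ Suc (Suc n) / h) \<longlongrightarrow> 0) (at 0)"
      by (rule Lim_transform_eventually)
         (auto simp: eventually_at_filter max_def field_simps intro!: always_eventually)
    then show ?thesis
      using 2 by (simp add: has_field_derivative_iff)
  qed
qed

text \<open>A partial derivative of \<open>p\<close> times the power \<open>m + 2\<close> of the positive part is another polynomial times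
the power \<open>m + 1\<close>. The polynomial factor is there to make this induction on \<open>m\<close> go through.\<close>

lemma Cm_fun_polynomial_mult_pos_part:
  fixes p :: "real ^ 'n \<Rightarrow> real"
  assumes "real_polynomial_function p"
  shows "Cm_fun m (\<lambda>x. p x * max 0 (1 - x \<bullet> x) ^ Suc m)"
  using assms
proof (induction m arbitrary: p)
  case 0
  have "continuous_on UNIV p"
    using 0 by (intro differentiable_imp_continuous_on differentiable_on_real_polynomial_function)
  then show ?case by (auto intro!: continuous_intros)
next
  case (Suc m)
  define q where "q i x = partial_deriv i p x * (1 - x \<bullet> x) - real (Suc (Suc m)) * 2 * x $ i * p x"
    for i and x :: "real ^ 'n"
  have q: "real_polynomial_function (q i)" for i
    unfolding q_def
    by (intro real_polynomial_function_diff real_polynomial_function.intros Suc.prems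
        real_polynomial_function_partial_deriv real_polynomial_function_inner_self bounded_linear_vec_nth)
  have D: "((\<lambda>x. p x * max 0 (1 - x \<bullet> x) ^ Suc (Suc m)) has_derivative
      (\<lambda>h. p x * (real (Suc (Suc m)) * max 0 (1 - x \<bullet> x) ^ Suc m * (- (x \<bullet> h + h \<bullet> x)))
         + p' h * max 0 (1 - x \<bullet> x) ^ Suc (Suc m))) (at x)"
    if "(p has_derivative p') (at x)" for x p'
  proof (rule has_derivative_mult[OF that])
    have "((\<lambda>x::real^'n. 1 - x \<bullet> x) has_derivative (\<lambda>h. - (x \<bullet> h + h \<bullet> x))) (at x)"
      by (auto intro!: derivative_eq_intros)
    from diff_chain_at[OF this DERIV_pos_part_power[unfolded has_field_derivative_def, of m]]
    show "((\<lambda>x. max 0 (1 - x \<bullet> x) ^ Suc (Suc m)) has_derivative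
       (\<lambda>h. real (Suc (Suc m)) * max 0 (1 - x \<bullet> x) ^ Suc m * (- (x \<bullet> h + h \<bullet> x)))) (at x)"
      by (simp only: o_def)
  qed
  have ex: "\<exists>p'. (p has_derivative p') (at x)" for x
    using differentiable_at_real_polynomial_function[OF Suc.prems, of x UNIV]
    by (auto simp: differentiable_def)
  have "partial_deriv i (\<lambda>x. p x * max 0 (1 - x \<bullet> x) ^ Suc (Suc m)) x = q i x * max 0 (1 - x \<bullet> x) ^ Suc m"
    for i x
  proof -
    obtain p' where p': "(p has_derivative p') (at x)" using ex by blast
    have sq: "max 0 (1 - x \<bullet> x) ^ Suc (Suc m) = (1 - x \<bullet> x) * max 0 (1 - x \<bullet> x) ^ Suc m"
      by (auto simp: max_def)
    have "x \<bullet> axis i 1 = x $ i" "axis i 1 \<bullet> x = x $ i"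
      by (simp_all add: cart_eq_inner_axis inner_commute)
    then show ?thesis
      using partial_deriv_has_derivative[OF D[OF p'], of i] partial_deriv_has_derivative[OF p', of i]
      unfolding q_def sq by (simp add: algebra_simps)
  qed
  then have "partial_deriv i (\<lambda>x. p x * max 0 (1 - x \<bullet> x) ^ Suc (Suc m)) = (\<lambda>x. q i x * max 0 (1 - x \<bullet> x) ^ Suc m)" for i
    by blast
  moreover have "(\<lambda>x. p x * max 0 (1 - x \<bullet> x) ^ Suc (Suc m)) differentiable_on UNIV"
    using D ex by (auto simp: differentiable_on_eq_differentiable_at differentiable_def) blast
  ultimately show ?case
    using Suc.IH[OF q] by (simp del: power_Suc)
qed

definition bump :: "nat \<Rightarrow> real ^ 'n \<Rightarrow> real" where
  "bump m x = max 0 (1 - x \<bullet> x) ^ Suc m"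

lemma Cm_fun_bump: "Cm_fun m (bump m :: real ^ 'n \<Rightarrow> real)"
  using Cm_fun_polynomial_mult_pos_part[of "\<lambda>_. 1", OF real_polynomial_function.intros(2), of m]
  unfolding bump_def[abs_def] by simp

lemma bump_nonneg: "0 \<le> bump m x"
  by (simp add: bump_def)

lemma bump_eq_0: "x \<notin> cball 0 1 \<Longrightarrow> bump m x = 0"
  by (auto simp: bump_def dot_square_norm abs_square_le_1 max_def not_le)

text \<open>The derivatives are continuous and supported in the unit ball, and there are only finitely many lists
of length at most \<open>m\<close>.\<close>

lemma bump_iter_partial_bounded:
  obtains C where "0 < C" "\<And>js x. length js \<le> m \<Longrightarrow> \<bar>iter_partial js (bump m :: real ^ 'n \<Rightarrow> real) x\<bar> \<le> C"
proof -
  have "\<exists>C. \<forall>x. \<bar>iter_partial js (bump m :: real ^ 'n \<Rightarrow> real) x\<bar> \<le> C" if "length js \<le> m" for js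
  proof -
    let ?f = "iter_partial js (bump m :: real ^ 'n \<Rightarrow> real)"
    have "continuous_on UNIV ?f"
      using Cm_fun_iter_partial[OF Cm_fun_bump that] by (rule Cm_fun_continuous)
    then have "bounded (?f ` cball 0 1)"
      by (intro compact_imp_bounded compact_continuous_image) (auto intro: continuous_on_subset)
    then obtain C where C: "\<And>x. x \<in> cball 0 1 \<Longrightarrow> \<bar>?f x\<bar> \<le> C"
      unfolding bounded_iff by fastforce
    have "\<bar>?f x\<bar> \<le> max C 0" for x
      using C[of x] iter_partial_support[of "cball 0 1" "bump m" x js] bump_eq_0
      by (cases "x \<in> cball 0 1") (auto simp: le_max_iff_disj)
    then show ?thesis by blast
  qed
  then obtain C where C: "\<And>js x. length js \<le> m \<Longrightarrow> \<bar>iter_partial js (bump m :: real ^ 'n \<Rightarrow> real) x\<bar> \<le> C js"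
    by metis
  define L where "L = {js :: 'n list. length js \<le> m}"
  have fin: "finite L"
    using finite_lists_length_le[of "UNIV :: 'n set" m] by (simp add: L_def)
  show thesis
  proof
    show "0 < 1 + (\<Sum>js\<in>L. \<bar>C js\<bar>)"
      by (simp add: add_pos_nonneg sum_nonneg)
    fix js :: "'n list" and x :: "real ^ 'n"
    assume js: "length js \<le> m"
    have "\<bar>C js\<bar> \<le> (\<Sum>js\<in>L. \<bar>C js\<bar>)"
      using js fin by (intro member_le_sum) (auto simp: L_def)
    then show "\<bar>iter_partial js (bump m) x\<bar> \<le> 1 + (\<Sum>js\<in>L. \<bar>C js\<bar>)"
      using C[OF js, of x] by linarith
  qed
qed

section \<open>Integrals of the bump\<close>

lemma integral_translate:
  fixes f :: "'a::euclidean_space \<Rightarrow> 'b::{banach, second_countable_topology}"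
  assumes [measurable]: "f \<in> borel_measurable borel"
  shows "(LINT x|lborel. f (x - p)) = (LINT x|lborel. f x)"
proof -
  have "(LINT x|lborel. f x) = (LINT x|distr lborel borel ((+) (- p)). f x)"
    by (simp add: lborel_distr_plus)
  also have "\<dots> = (LINT x|lborel. f (x - p))"
    by (subst integral_distr) auto
  finally show ?thesis ..
qed

lemma integral_stretch:
  fixes f :: "real ^ 'n \<Rightarrow> real"
  assumes [measurable]: "f \<in> borel_measurable borel" and "0 < N" "0 < l"
  shows "(LINT x|lborel. f (stretch e N l x)) = (LINT x|lborel. f x) / (N * l ^ CARD('n))"
proof -
  define c where "c j = l * (if j = axis e (1::real) then N else 1)" for j :: "real ^ 'n"
  have stretch: "stretch e N l x = 0 + (\<Sum>j\<in>Basis. (c j * (x \<bullet> j)) *\<^sub>R j)" for x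
  proof (rule euclidean_eqI)
    fix b :: "real ^ 'n" assume b: "b \<in> Basis"
    then obtain i where i: "b = axis i 1" by (auto simp: Basis_vec_def)
    have "stretch e N l x \<bullet> b = c b * (x \<bullet> b)"
      by (simp add: i c_def cart_eq_inner_axis[symmetric] stretch_component axis_eq_axis)
    also have "\<dots> = (0 + (\<Sum>j\<in>Basis. (c j * (x \<bullet> j)) *\<^sub>R j)) \<bullet> b"
      using b by simp
    finally show "stretch e N l x \<bullet> b = (0 + (\<Sum>j\<in>Basis. (c j * (x \<bullet> j)) *\<^sub>R j)) \<bullet> b" .
  qed
  have [measurable]: "stretch e N l \<in> borel_measurable borel"
    by (intro borel_measurable_continuous_onI continuous_on_stretch[of UNIV "\<lambda>x. x"] continuous_on_id)
  have "\<bar>c j\<bar> = l * (if j = axis e (1::real) then N else 1)" for j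
    using assms by (simp add: c_def)
  then have "(\<Prod>j\<in>Basis. \<bar>c j\<bar>)
      = (\<Prod>j\<in>(Basis :: (real ^ 'n) set). l) * (\<Prod>j\<in>Basis. if j = axis e (1::real) then N else 1)"
    by (simp only: prod.distrib)
  also have "\<dots> = l ^ CARD('n) * N"
    by (simp add: prod.delta)
  finally have c: "(\<Prod>j\<in>Basis. \<bar>c j\<bar>) = N * l ^ CARD('n)" by simp
  have "lborel = density (distr lborel borel (stretch e N l)) (\<lambda>_. ennreal (\<Prod>j\<in>Basis. \<bar>c j\<bar>))"
    using lborel_affine_euclidean[of c 0] assms(2,3) unfolding stretch[abs_def] by (auto simp: c_def)
  then have "(LINT x|lborel. f x)
      = (LINT x|density (distr lborel borel (stretch e N l)) (\<lambda>_. ennreal (N * l ^ CARD('n))). f x)"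
    unfolding c by simp
  also have "\<dots> = N * l ^ CARD('n) * (LINT x|lborel. f (stretch e N l x))"
    using assms(2,3) by (subst integral_density) (auto simp: integral_distr)
  finally show ?thesis
    using assms(2,3) by (simp add: field_simps)
qed

lemma integrable_compact_support:
  fixes f :: "'a::euclidean_space \<Rightarrow> 'b::{banach, second_countable_topology}"
  assumes "continuous_on UNIV f" "compact S" "\<And>x. x \<notin> S \<Longrightarrow> f x = 0"
  shows "integrable lborel f"
proof -
  have "integrable lborel (\<lambda>x. indicator S x *\<^sub>R f x)"
    using assms by (intro borel_integrable_compact) (auto intro: continuous_on_subset)
  moreover have "(\<lambda>x. indicator S x *\<^sub>R f x) = f"
    using assms(3) by (auto simp: fun_eq_iff indicator_def)
  ultimately show ?thesis by simp
qed

text \<open>If the integral vanished, the closed set of zeros would have full measure and would be everything.\<close>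

lemma integral_pos_of_continuous:
  fixes f :: "'a::euclidean_space \<Rightarrow> real"
  assumes f: "continuous_on UNIV f" "integrable lborel f" "\<And>x. 0 \<le> f x" and z: "f z \<noteq> 0"
  shows "0 < (LINT x|lborel. f x)"
proof (rule ccontr)
  assume "\<not> 0 < (LINT x|lborel. f x)"
  moreover have "0 \<le> (LINT x|lborel. f x)" using f by (intro integral_nonneg_AE) auto
  ultimately have "(LINT x|lborel. f x) = 0" by linarith
  then have "AE x in lborel. f x = 0"
    using f integral_nonneg_eq_0_iff_AE[of lborel f] by auto
  then have "AE x in lebesgue. x \<in> {x. f x = 0}"
    by (simp add: AE_completion)
  moreover have "closed {x. f x = 0}"
    using f(1) by (intro closed_Collect_eq) auto
  ultimately have "f z = 0"
    using mem_closed_if_AE_lebesgue by blast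
  then show False using z by simp
qed

section \<open>Trains of bumps\<close>

definition spike :: "nat \<Rightarrow> 'n \<Rightarrow> nat \<Rightarrow> real \<Rightarrow> real ^ 'n \<Rightarrow> real" where
  "spike m e N l x = bump m (stretch e (real N) l x)"

text \<open>In the stretched coordinate the centres are at distance \<open>3\<close>, which exceeds the diameter \<open>2\<close> of
the stretched supports; a row of \<open>2 * N\<close> bumps still has length of order \<open>1 / l\<close>.\<close>

definition centre :: "'n \<Rightarrow> nat \<Rightarrow> real \<Rightarrow> real ^ 'n \<Rightarrow> nat \<Rightarrow> real ^ 'n" where
  "centre e N l x0 j = x0 + (3 * real j / (l * real N)) *\<^sub>R axis e 1"

definition bump_train ::
    "nat \<Rightarrow> 'n \<Rightarrow> nat \<Rightarrow> real \<Rightarrow> real ^ 'n \<Rightarrow> (nat \<Rightarrow> real) \<Rightarrow> real ^ 'n \<Rightarrow> real" where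
  "bump_train m e N l x0 b x = (\<Sum>j<2*N. b j * spike m e N l (x - centre e N l x0 j))"

lemma spike_eq_0: "1 < norm (stretch e (real N) l x) \<Longrightarrow> spike m e N l x = 0"
  by (simp add: spike_def bump_eq_0)

lemma spikes_disjoint:
  assumes "i \<noteq> j" "1 \<le> N" "0 < l"
    and "norm (stretch e (real N) l (x - centre e N l x0 i)) \<le> 1"
    and "norm (stretch e (real N) l (x - centre e N l x0 j)) \<le> 1"
  shows False
proof -
  let ?d = "stretch e (real N) l (x - centre e N l x0 j) - stretch e (real N) l (x - centre e N l x0 i)"
  have "?d $ e = 3 * (real i - real j)"
    using assms(2,3) by (simp add: stretch_component centre_def field_simps)
  moreover have "\<bar>?d $ e\<bar> \<le> norm ?d" by (rule component_le_norm_cart)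
  moreover have "norm ?d \<le> 2"
    using norm_triangle_ineq4[of "stretch e (real N) l (x - centre e N l x0 j)"
        "stretch e (real N) l (x - centre e N l x0 i)"] assms(4,5) by linarith
  ultimately have "3 * \<bar>real i - real j\<bar> \<le> 2" by (simp add: abs_mult)
  moreover have "1 \<le> \<bar>real i - real j\<bar>" using assms(1) by linarith
  ultimately show False by argo
qed

lemma bump_train_eq_0:
  assumes "1 \<le> N" "0 < l" "x \<notin> cball x0 (7 / l)"
  shows "bump_train m e N l x0 b x = 0"
  unfolding bump_train_def
proof (rule sum.neutral, rule ballI)
  fix j assume "j \<in> {..<2*N}"
  then have "3 * real j / (l * real N) \<le> 6 / l"
    using assms(1,2) by (simp add: field_simps)
  then have "norm (centre e N l x0 j - x0) \<le> 6 / l"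
    using assms(2) by (simp add: centre_def)
  moreover have "7 / l < norm (x - x0)"
    using assms(3) by (simp add: dist_norm norm_minus_commute)
  moreover have "norm (x - x0) \<le> norm (x - centre e N l x0 j) + norm (centre e N l x0 j - x0)"
    using norm_triangle_ineq[of "x - centre e N l x0 j" "centre e N l x0 j - x0"] by simp
  ultimately have "1 / l < norm (x - centre e N l x0 j)"
    by (simp add: field_simps)
  then have "1 < l * norm (x - centre e N l x0 j)"
    using assms(2) by (simp add: field_simps)
  also have "\<dots> \<le> norm (stretch e (real N) l (x - centre e N l x0 j))"
    using assms by (intro norm_le_norm_stretch) auto
  finally show "b j * spike m e N l (x - centre e N l x0 j) = 0"
    by (simp add: spike_eq_0)
qed

lemma Cm_fun_spike: "Cm_fun m (spike m e N l)"
  unfolding spike_def[abs_def] using Cm_fun_bump by (rule Cm_fun_stretch)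

lemma Cm_fun_bump_train: "Cm_fun m (bump_train m e N l x0 b)"
  unfolding bump_train_def[abs_def]
  by (intro Cm_fun_sum Cm_fun_translate Cm_fun_spike)

lemma abs_sum_le_of_at_most_one:
  fixes g :: "'a \<Rightarrow> real"
  assumes "\<And>i j. i \<in> J \<Longrightarrow> j \<in> J \<Longrightarrow> i \<noteq> j \<Longrightarrow> g i = 0 \<or> g j = 0"
    and "\<And>j. j \<in> J \<Longrightarrow> \<bar>g j\<bar> \<le> M" "0 \<le> M"
  shows "\<bar>sum g J\<bar> \<le> M"
proof (cases "\<exists>k\<in>J. g k \<noteq> 0")
  case True
  then obtain k where k: "k \<in> J" "g k \<noteq> 0" by blast
  show ?thesis
  proof (cases "finite J")
    case True
    have "sum g J = sum g {k}"
      using assms(1) k True by (intro sum.mono_neutral_right) auto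
    then show ?thesis using assms(2) k by simp
  qed (use assms in simp)
next
  case False
  then show ?thesis using assms(3) by simp
qed

text \<open>At every point at most one bump contributes, whence the bound does not grow with the number of
bumps, apart from the factor \<open>N ^ m\<close> due to their width.\<close>

lemma iter_partial_bump_train_le:
  fixes e :: "'n::finite"
  assumes "1 \<le> N" "1 \<le> l" "length js \<le> m"
    and C: "\<And>x. \<bar>iter_partial js (bump m :: real ^ 'n \<Rightarrow> real) x\<bar> \<le> C"
    and b: "\<And>j. j < 2 * N \<Longrightarrow> \<bar>b j\<bar> \<le> h"
  shows "\<bar>iter_partial js (bump_train m e N l x0 b) x\<bar> \<le> h * ((l * real N) ^ m * C)"
proof -
  let ?S = "\<lambda>j. {x. norm (stretch e (real N) l (x - centre e N l x0 j)) \<le> 1}"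
  have "0 \<le> C" using C[of 0] by linarith
  have "0 \<le> h" using b[of 0] assms(1) by fastforce
  have closed: "closed (?S j)" for j
    by (intro closed_Collect_le continuous_intros)
  have zero: "iter_partial js (\<lambda>x. spike m e N l (x - centre e N l x0 j)) x = 0" if "x \<notin> ?S j" for j
    by (rule iter_partial_support[OF closed _ that]) (auto simp: spike_eq_0)
  have eq: "iter_partial js (bump_train m e N l x0 b) x
      = (\<Sum>j<2*N. b j * iter_partial js (\<lambda>x. spike m e N l (x - centre e N l x0 j)) x)"
    unfolding bump_train_def[abs_def]
    by (subst iter_partial_sum[of _ m]) (auto intro: Cm_fun_translate Cm_fun_spike assms(3))
  show ?thesis
    unfolding eq
  proof (rule abs_sum_le_of_at_most_one)
    fix i j :: nat assume "i \<noteq> j"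
    then have "x \<notin> ?S i \<or> x \<notin> ?S j"
      using spikes_disjoint[of i j N l e x x0] assms(1,2) by auto
    then show "b i * iter_partial js (\<lambda>x. spike m e N l (x - centre e N l x0 i)) x = 0 \<or>
       b j * iter_partial js (\<lambda>x. spike m e N l (x - centre e N l x0 j)) x = 0"
      using zero[of i] zero[of j] by auto
  next
    fix j assume j: "j \<in> {..<2*N}"
    have "\<bar>iter_partial js (\<lambda>x. spike m e N l (x - centre e N l x0 j)) x\<bar> \<le> (l * real N) ^ m * C"
      unfolding iter_partial_translate[of js "spike m e N l"] unfolding spike_def[abs_def]
      using assms by (intro abs_iter_partial_stretch_le Cm_fun_bump) auto
    then show "\<bar>b j * iter_partial js (\<lambda>x. spike m e N l (x - centre e N l x0 j)) x\<bar>
        \<le> h * ((l * real N) ^ m * C)"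
      using b[of j] j \<open>0 \<le> h\<close> unfolding abs_mult by (intro mult_mono) auto
  qed (use \<open>0 \<le> C\<close> \<open>0 \<le> h\<close> assms in auto)
qed

lemma continuous_on_bump: "continuous_on UNIV (bump m :: real ^ 'n \<Rightarrow> real)"
  using Cm_fun_bump by (rule Cm_fun_continuous)

lemma continuous_on_spike: "continuous_on UNIV (spike m e N l)"
  using Cm_fun_spike by (rule Cm_fun_continuous)

lemma borel_measurable_bump [measurable]: "bump m \<in> borel_measurable (borel :: (real ^ 'n) measure)"
  using continuous_on_bump by (rule borel_measurable_continuous_onI)

lemma borel_measurable_spike [measurable]: "spike m e N l \<in> borel_measurable borel"
  using continuous_on_spike by (rule borel_measurable_continuous_onI)

lemma spike_translate_eq_0:
  assumes "1 \<le> N" "0 < l" "x \<notin> cball p (1 / l)"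
  shows "spike m e N l (x - p) = 0"
proof (rule spike_eq_0)
  have "1 < l * norm (x - p)"
    using assms by (simp add: dist_norm norm_minus_commute field_simps)
  also have "\<dots> \<le> norm (stretch e (real N) l (x - p))"
    using assms by (intro norm_le_norm_stretch) auto
  finally show "1 < norm (stretch e (real N) l (x - p))" .
qed

lemma integrable_spike_translate:
  fixes g :: "real ^ 'n \<Rightarrow> 'b::{banach, real_normed_algebra, second_countable_topology}"
  assumes "1 \<le> N" "0 < l" "continuous_on UNIV g" "0 < k"
  shows "integrable lborel (\<lambda>x. spike m e N l (x - p) ^ k *\<^sub>R g x)"
proof (rule integrable_compact_support)
  show "continuous_on UNIV (\<lambda>x. spike m e N l (x - p) ^ k *\<^sub>R g x)"
    by (intro continuous_intros assms(3) continuous_on_compose2[OF continuous_on_spike]) auto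
  show "compact (cball p (1 / l))" by simp
  show "spike m e N l (x - p) ^ k *\<^sub>R g x = 0" if "x \<notin> cball p (1 / l)" for x
    using spike_translate_eq_0[OF assms(1,2) that] assms(4) by simp
qed

lemma integral_bump_power_pos:
  assumes "0 < k"
  shows "0 < (LINT x|lborel. (bump m (x :: real ^ 'n)) ^ k)"
proof (rule integral_pos_of_continuous[of _ 0])
  show c: "continuous_on UNIV (\<lambda>x :: real ^ 'n. bump m x ^ k)"
    by (intro continuous_intros continuous_on_bump)
  show "integrable lborel (\<lambda>x :: real ^ 'n. bump m x ^ k)"
    using assms by (intro integrable_compact_support[OF c, of "cball 0 1"]) (auto simp: bump_eq_0)
qed (auto simp: bump_nonneg bump_def)

lemma integral_spike_power:
  fixes e :: "'n::finite"
  assumes "1 \<le> N" "0 < l"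
  shows "(LINT x|lborel. spike m e N l (x - p) ^ k)
    = (LINT x|lborel. (bump m (x :: real ^ 'n)) ^ k) / (real N * l ^ CARD('n))"
  using assms integral_stretch[of "\<lambda>x. bump m x ^ k" "real N" l e]
  by (subst integral_translate[of "\<lambda>x. spike m e N l x ^ k"]) (measurable, auto simp: spike_def)

text \<open>The cross terms vanish because the supports are disjoint.\<close>

lemma integral_bump_train_sq:
  fixes e :: "'n::finite"
  assumes "1 \<le> N" "0 < l"
  shows "(LINT x|lborel. (bump_train m e N l x0 b x)\<^sup>2)
    = (\<Sum>j<2*N. (b j)\<^sup>2) * ((LINT x|lborel. (bump m (x :: real ^ 'n))\<^sup>2) / (real N * l ^ CARD('n)))"
proof -
  let ?s = "\<lambda>j x. spike m e N l (x - centre e N l x0 j)"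
  have disjoint: "?s i x * ?s j x = 0" if "i \<noteq> j" for i j x
    using spikes_disjoint[OF that assms, of e x x0] spike_eq_0 by (metis mult_eq_0_iff not_le)
  have "(bump_train m e N l x0 b x)\<^sup>2 = (\<Sum>j<2*N. (b j)\<^sup>2 * (?s j x)\<^sup>2)" for x
  proof -
    have "(bump_train m e N l x0 b x)\<^sup>2 = (\<Sum>i<2*N. \<Sum>j<2*N. b i * b j * (?s i x * ?s j x))"
      by (simp add: bump_train_def power2_eq_square sum_product mult_ac)
    also have "\<dots> = (\<Sum>i<2*N. \<Sum>j<2*N. if j = i then (b i)\<^sup>2 * (?s i x)\<^sup>2 else 0)"
      by (intro sum.cong) (use disjoint in \<open>auto simp: power2_eq_square\<close>)
    finally show ?thesis by simp
  qed
  then have "(LINT x|lborel. (bump_train m e N l x0 b x)\<^sup>2)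
      = (\<Sum>j<2*N. (b j)\<^sup>2 * (LINT x|lborel. (?s j x)\<^sup>2))"
    using integrable_spike_translate[OF assms, of "\<lambda>_. 1::real" 2 m e]
    by (simp add: Bochner_Integration.integral_sum)
  then show ?thesis
    by (simp only: integral_spike_power[OF assms] sum_distrib_right)
qed

section \<open>Fourier transform of a train\<close>

text \<open>All bumps are translates of one function. The transform of the train is therefore the transform of a
single bump, bounded by its integral, times an exponential sum over the centres.\<close>

lemma cmod_fourier_bump_train_le:
  fixes e :: "'n::finite"
  assumes "1 \<le> N" "1 \<le> l"
  shows "cmod (fourier (bump_train m e N l x0 b) \<xi>) \<le> (LINT x|lborel. bump m (x :: real ^ 'n))
    * cmod (\<Sum>j<2*N. of_real (b j) * iexp (\<xi> $ e * (3 * real j / (l * real N))))"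
proof -
  have l: "0 < l" using assms by simp
  let ?c = "centre e N l x0"
  let ?t = "\<lambda>j. \<xi> $ e * (3 * real j / (l * real N))"
  define S where "S = (LINT y|lborel. iexp (\<xi> \<bullet> y) * of_real (spike m e N l y))"
  have shift: "(LINT x|lborel. iexp (\<xi> \<bullet> x) * of_real (spike m e N l (x - ?c j))) = iexp (\<xi> \<bullet> x0) * iexp (?t j) * S" for j
  proof -
    have "\<xi> \<bullet> ?c j = \<xi> \<bullet> x0 + ?t j"
      by (simp add: centre_def inner_add_right cart_eq_inner_axis)
    then have phase: "iexp (\<xi> \<bullet> x) = iexp (\<xi> \<bullet> x0) * iexp (?t j) * iexp (\<xi> \<bullet> (x - ?c j))" for x
      by (simp add: exp_add[symmetric] inner_diff_right algebra_simps)
    have "(LINT x|lborel. iexp (\<xi> \<bullet> x) * of_real (spike m e N l (x - ?c j)))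
        = (LINT x|lborel. iexp (\<xi> \<bullet> x0) * iexp (?t j) * (iexp (\<xi> \<bullet> (x - ?c j)) * of_real (spike m e N l (x - ?c j))))"
      by (subst phase) (simp only: mult.assoc)
    also have "\<dots> = (LINT y|lborel. iexp (\<xi> \<bullet> x0) * iexp (?t j) * (iexp (\<xi> \<bullet> y) * of_real (spike m e N l y)))"
      by (rule integral_translate[of "\<lambda>y. iexp (\<xi> \<bullet> x0) * iexp (?t j) * (iexp (\<xi> \<bullet> y) * of_real (spike m e N l y))"]) measurable
    finally show ?thesis by (simp add: S_def)
  qed
  have int: "integrable lborel (\<lambda>x. iexp (\<xi> \<bullet> x) * of_real (spike m e N l (x - ?c j)))" for j
    using integrable_spike_translate[OF assms(1) l, of "\<lambda>x. iexp (\<xi> \<bullet> x)" 1 m e "?c j"]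
    by (simp add: continuous_intros scaleR_conv_of_real mult.commute)
  have "(LINT x|lborel. iexp (\<xi> \<bullet> x) * of_real (bump_train m e N l x0 b x))
      = (LINT x|lborel. (\<Sum>j<2*N. of_real (b j) * (iexp (\<xi> \<bullet> x) * of_real (spike m e N l (x - ?c j)))))"
    by (intro Bochner_Integration.integral_cong refl)
       (simp add: bump_train_def sum_distrib_left mult_ac)
  also have "\<dots> = (\<Sum>j<2*N. of_real (b j) * (iexp (\<xi> \<bullet> x0) * iexp (?t j) * S))"
    using int by (simp add: Bochner_Integration.integral_sum shift)
  also have "\<dots> = iexp (\<xi> \<bullet> x0) * S * (\<Sum>j<2*N. of_real (b j) * iexp (?t j))"
    by (simp add: sum_distrib_left mult_ac)
  finally have F: "fourier (bump_train m e N l x0 b) \<xi> = complex_of_real (1 / (2 * pi) ^ CARD('n)) *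
      (iexp (\<xi> \<bullet> x0) * S * (\<Sum>j<2*N. of_real (b j) * iexp (?t j)))"
    by (simp add: fourier_def)
  have "cmod S \<le> (LINT y|lborel. cmod (iexp (\<xi> \<bullet> y) * of_real (spike m e N l y)))"
    unfolding S_def by (rule integral_norm_bound)
  also have "\<dots> = (LINT y|lborel. spike m e N l (y - 0) ^ 1)"
    by (simp add: norm_mult spike_def bump_nonneg)
  also have "\<dots> = (LINT x|lborel. bump m (x :: real ^ 'n)) / (real N * l ^ CARD('n))"
    using integral_spike_power[OF assms(1) l, of m e 0 1] by simp
  also have "\<dots> \<le> (LINT x|lborel. bump m (x :: real ^ 'n))"
  proof -
    have "1 \<le> real N * l ^ CARD('n)"
      using assms by (intro mult_ge1_I one_le_power) auto
    moreover have "0 \<le> (LINT x|lborel. bump m (x :: real ^ 'n))"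
      using bump_nonneg by (intro integral_nonneg_AE) auto
    ultimately show ?thesis
      by (smt (verit) divide_le_eq mult_left_mono mult.commute mult_cancel_left2)
  qed
  finally have S: "cmod S \<le> (LINT x|lborel. bump m (x :: real ^ 'n))" .
  have "1 \<le> (2 * pi) ^ CARD('n)"
    using pi_ge_two by (intro one_le_power) simp
  then have "cmod (complex_of_real (1 / (2 * pi) ^ CARD('n))) \<le> 1"
    unfolding norm_of_real by (simp add: abs_mult power_abs divide_le_eq_1)
  then have "cmod (fourier (bump_train m e N l x0 b) \<xi>) \<le> 1 * (1 * cmod S * cmod (\<Sum>j<2*N. of_real (b j) * iexp (?t j)))"
    unfolding F norm_mult by (intro mult_mono) auto
  also have "\<dots> \<le> (LINT x|lborel. bump m (x :: real ^ 'n)) * cmod (\<Sum>j<2*N. of_real (b j) * iexp (?t j))"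
    using S by (simp add: mult_right_mono)
  finally show ?thesis .
qed

lemma Linf_norm_fourier_le:
  fixes v :: "real ^ 'n \<Rightarrow> real"
  assumes [measurable]: "v \<in> borel_measurable borel"
    and "closed B" and M: "\<And>\<xi>. \<xi> \<in> B \<Longrightarrow> cmod (fourier v \<xi>) \<le> M"
  shows "Linf_norm B (fourier v) \<le> ennreal M"
  unfolding Linf_norm_def
proof (rule esssup_I)
  have "fourier v \<in> borel_measurable borel"
    unfolding fourier_def[abs_def] by measurable
  then have "(\<lambda>\<xi>. ennreal (cmod (fourier v \<xi>))) \<in> borel_measurable lebesgue"
    by (intro measurable_completion) simp
  then show "(\<lambda>\<xi>. ennreal (cmod (fourier v \<xi>))) \<in> borel_measurable (lebesgue_on B)"
    by (rule measurable_restrict_space1)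
  show "AE \<xi> in lebesgue_on B. ennreal (cmod (fourier v \<xi>)) \<le> ennreal M"
    using M by (intro AE_I2) (auto simp: space_restrict_space intro: ennreal_leI)
qed

section \<open>Trains with small Fourier transform and large norm\<close>

lemma log_modulus_le:
  assumes "0 \<le> t" "t \<le> exp (- s)" "0 < s" "0 \<le> \<mu>"
  shows "log_modulus \<mu> t \<le> s powr (- \<mu>)"
proof (cases "t = 0")
  case False
  then have "ln t \<le> ln (exp (- s))"
    using assms by (subst ln_le_cancel_iff) auto
  then have "s \<le> ln (1 / t)"
    using False assms by (simp add: ln_div)
  then show ?thesis
    using False assms by (simp add: log_modulus_def powr_mono2')
qed (simp add: log_modulus_def)

theorem theorem5p2:
  fixes m :: nat and \<mu> \<gamma> c :: real and A B :: "(real ^ 'n) set"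
  assumes "\<mu> > 0"
    and "CARD('n) \<ge> 2 \<Longrightarrow> \<mu> > real m"
    and "CARD('n) = 1 \<Longrightarrow> \<mu> > real m + 1 / 2"
    and "A \<noteq> {}" and "bounded A" and "open A"
    and "compact B"
    and "\<gamma> > 0" and "c > 0"
  shows "\<exists>v :: real ^ 'n \<Rightarrow> real.
    closure {x. v x \<noteq> 0} \<subseteq> A \<and>
    Cm_fun m v \<and> Cm_norm m v \<le> ennreal \<gamma> \<and>
    Linf_norm B (fourier v) < 1 \<and>
    L2_norm v > c * log_modulus \<mu> (enn2real (Linf_norm B (fourier v)))"
proof -
  have "CARD('n) \<noteq> 0" by simp
  then have \<mu>: "real m < \<mu>"
    using assms(2,3) by linarith
  obtain e :: 'n where True by blast
  obtain x0 \<rho> where x0: "0 < \<rho>" "cball x0 \<rho> \<subseteq> A"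
    using assms(4,6) open_contains_cball by blast
  \<comment> \<open>A train with parameter \<open>l\<close> is supported in the ball of radius \<open>7 / l\<close> around \<open>x0\<close>.\<close>
  define l where "l = max 1 (7 / \<rho>)"
  have l: "1 \<le> l" "0 < l" "7 / l \<le> \<rho>"
    using x0 by (auto simp: l_def field_simps max_def)
  obtain R where R: "\<And>\<xi>. \<xi> \<in> B \<Longrightarrow> norm \<xi> \<le> R" "0 < R"
    using compact_imp_bounded[OF assms(7)] bounded_pos by metis
  obtain C where C: "0 < C"
      "\<And>js x. length js \<le> m \<Longrightarrow> \<bar>iter_partial js (bump m :: real ^ 'n \<Rightarrow> real) x\<bar> \<le> C"
    using bump_iter_partial_bounded by blast
  define I1 where "I1 = (LINT x|lborel. bump m (x :: real ^ 'n))"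
  define I2 where "I2 = (LINT x|lborel. (bump m (x :: real ^ 'n))\<^sup>2)"
  have I: "0 < I1" "0 < I2"
    using integral_bump_power_pos[where 'n = 'n, of 1 m] integral_bump_power_pos[where 'n = 'n, of 2 m]
    by (simp_all add: I1_def I2_def)
  \<comment> \<open>\<open>c1 / N ^ m\<close> is the lower bound for the norm in \<open>L\<^sup>2\<close> of the function \<open>v\<close> defined below.\<close>
  define c1 where "c1 = \<gamma> / (l ^ m * C) * sqrt (I2 / l ^ CARD('n))"
  have "0 < c1"
    using assms(8) l C I by (simp add: c1_def)
  have "eventually (\<lambda>N. c / c1 < real N powr (\<mu> - real m)) sequentially"
  proof -
    define M where "M = (c / c1) powr (1 / (\<mu> - real m))"
    have "M powr (\<mu> - real m) = c / c1"
      using \<mu> assms(9) \<open>0 < c1\<close> by (simp add: M_def powr_powr)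
    moreover have "M powr (\<mu> - real m) < real N powr (\<mu> - real m)" if "M < real N" for N
      using that \<mu> by (intro powr_less_mono2) (auto simp: M_def)
    moreover have "eventually (\<lambda>N. M < real N) sequentially"
      using filterlim_real_sequentially by (simp add: filterlim_at_top_dense)
    ultimately show ?thesis by (auto elim: eventually_mono)
  qed
  moreover have "eventually (\<lambda>N. (2 * (\<gamma> / C) * I1) * real N * ((6 * R) ^ N / fact N) \<le> exp (- real N)) sequentially"
    using assms(8) C I R by (intro eventually_power_over_fact_le_exp) auto
  ultimately have "eventually (\<lambda>N. c / c1 < real N powr (\<mu> - real m) \<and>
      (2 * (\<gamma> / C) * I1) * real N * ((6 * R) ^ N / fact N) \<le> exp (- real N) \<and> 1 \<le> N) sequentially"
    by (intro eventually_conj eventually_ge_at_top)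
  then obtain N where N: "c / c1 < real N powr (\<mu> - real m)"
      "(2 * (\<gamma> / C) * I1) * real N * ((6 * R) ^ N / fact N) \<le> exp (- real N)" "1 \<le> N"
    by (auto simp: eventually_sequentially)
  define s where "s j = 3 * real j / (l * real N)" for j
  obtain a where a: "\<And>j. j < 2 * N \<Longrightarrow> \<bar>a j\<bar> \<le> 1"
      "\<And>k. k < N \<Longrightarrow> (\<Sum>j<2*N. a j * s j ^ k) = 0"
      "N \<le> card {j\<in>{..<2*N}. \<bar>a j\<bar> = 1}"
    using bounded_solution_mostly_saturated[of "{..<2*N}" N "\<lambda>k j. s j ^ k"] by auto
  \<comment> \<open>With this amplitude the bound on derivatives up to order \<open>m\<close> is exactly \<open>\<gamma>\<close>.\<close>
  define h where "h = \<gamma> / ((l * real N) ^ m * C)"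
  have lN: "1 \<le> l * real N" using l N by (intro mult_ge1_I) auto
  then have h: "0 < h" "h * ((l * real N) ^ m * C) = \<gamma>" "h \<le> \<gamma> / C"
    using assms(8) C l N one_le_power[OF lN, of m] by (auto simp: h_def field_simps)
  define v where "v = bump_train m e N l x0 (\<lambda>j. h * a j)"
  have Cm: "Cm_fun m v"
    unfolding v_def by (rule Cm_fun_bump_train)
  then have meas: "v \<in> borel_measurable borel"
    by (intro borel_measurable_continuous_onI Cm_fun_continuous)
  have "{x. v x \<noteq> 0} \<subseteq> cball x0 (7 / l)"
    unfolding v_def using bump_train_eq_0[OF N(3) l(2)] by blast
  then have "closure {x. v x \<noteq> 0} \<subseteq> cball x0 (7 / l)"
    by (rule closure_minimal) simp
  then have supp: "closure {x. v x \<noteq> 0} \<subseteq> A"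
    using x0 l by (meson order_trans subset_cball)
  have norm: "Cm_norm m v \<le> ennreal \<gamma>"
    unfolding Cm_norm_def
  proof (intro SUP_least ennreal_leI)
    fix js :: "'n list" and x assume "js \<in> {js. length js \<le> m}"
    then have "\<bar>iter_partial js v x\<bar> \<le> h * ((l * real N) ^ m * C)"
      unfolding v_def using N(3) l C a(1) h(1)
      by (intro iter_partial_bump_train_le) (auto simp: abs_mult mult_le_cancel_left1)
    then show "\<bar>iter_partial js v x\<bar> \<le> \<gamma>" using h(2) by simp
  qed
  have "cmod (fourier v \<xi>) \<le> exp (- real N)" if \<xi>: "\<xi> \<in> B" for \<xi>
  proof -
    \<comment> \<open>The positions \<open>s j\<close> lie between \<open>0\<close> and \<open>6 / l\<close>, where \<open>1 \<le> l\<close>.\<close>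
    have "\<bar>\<xi> $ e * s j\<bar> \<le> 6 * R" if "j \<in> {..<2*N}" for j
    proof -
      have "\<bar>\<xi> $ e\<bar> \<le> R"
        using R(1)[OF \<xi>] component_le_norm_cart[of \<xi> e] by linarith
      moreover have "s j \<le> 6" "0 \<le> s j"
      proof -
        have "3 * real j \<le> 6 * real N" using that by simp
        also have "\<dots> \<le> 6 * (l * real N)" using l by (simp add: mult_le_cancel_right1)
        finally show "s j \<le> 6" using lN by (simp add: s_def divide_le_eq)
        show "0 \<le> s j" using l by (simp add: s_def)
      qed
      ultimately have "\<bar>\<xi> $ e\<bar> * \<bar>s j\<bar> \<le> R * 6"
        by (intro mult_mono) auto
      then show ?thesis by (simp add: abs_mult)
    qed
    then have exp_sum: "cmod (\<Sum>j<2*N. of_real (a j) * iexp (\<xi> $ e * s j))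
        \<le> real (card {..<2*N}) * ((6 * R) ^ N / fact N)"
      using a N(3) by (intro exp_sum_bound_of_vanishing_moments) auto
    have "cmod (fourier v \<xi>) \<le> I1 * cmod (\<Sum>j<2*N. of_real (h * a j) * iexp (\<xi> $ e * s j))"
      unfolding v_def I1_def s_def using cmod_fourier_bump_train_le[OF N(3) l(1)] .
    also have "(\<Sum>j<2*N. of_real (h * a j) * iexp (\<xi> $ e * s j))
        = of_real h * (\<Sum>j<2*N. of_real (a j) * iexp (\<xi> $ e * s j))"
      by (simp add: sum_distrib_left mult.assoc)
    also have "I1 * cmod \<dots> \<le> I1 * ((\<gamma> / C) * (real (2 * N) * ((6 * R) ^ N / fact N)))"
      using exp_sum h I unfolding norm_mult by (intro mult_left_mono mult_mono) auto
    also have "\<dots> = (2 * (\<gamma> / C) * I1) * real N * ((6 * R) ^ N / fact N)"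
      by simp
    finally show ?thesis using N(2) by linarith
  qed
  then have Linf: "Linf_norm B (fourier v) \<le> ennreal (exp (- real N))"
    using meas compact_imp_closed[OF assms(7)] by (intro Linf_norm_fourier_le)
  also have "\<dots> < 1"
    using N(3) by (simp add: ennreal_less_one_iff)
  finally have Linf1: "Linf_norm B (fourier v) < 1" .
  have "enn2real (Linf_norm B (fourier v)) \<le> exp (- real N)"
    using enn2real_mono[OF Linf] by simp
  then have log: "log_modulus \<mu> (enn2real (Linf_norm B (fourier v))) \<le> real N powr (- \<mu>)"
    using N(3) assms(1) by (intro log_modulus_le) auto
  have "c1 / real N ^ m \<le> L2_norm v"
  proof -
    have "h\<^sup>2 * real N \<le> h\<^sup>2 * real (card {j\<in>{..<2*N}. \<bar>a j\<bar> = 1})"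
      using a(3) by (intro mult_left_mono) auto
    also have "\<dots> = (\<Sum>j\<in>{j\<in>{..<2*N}. \<bar>a j\<bar> = 1}. (h * a j)\<^sup>2)"
    proof -
      have "(h * a j)\<^sup>2 = h\<^sup>2" if "\<bar>a j\<bar> = 1" for j
        using that power2_abs[of "a j"] by (simp add: power_mult_distrib)
      then show ?thesis by simp
    qed
    also have "\<dots> \<le> (\<Sum>j<2*N. (h * a j)\<^sup>2)"
      by (intro sum_mono2) auto
    finally have "h\<^sup>2 * real N * (I2 / (real N * l ^ CARD('n))) \<le> (LINT x|lborel. (v x)\<^sup>2)"
      unfolding v_def integral_bump_train_sq[OF N(3) l(2)] I2_def[symmetric]
      using I l by (intro mult_right_mono) auto
    moreover have "h\<^sup>2 * real N * (I2 / (real N * l ^ CARD('n))) = h\<^sup>2 * (I2 / l ^ CARD('n))"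
      using N(3) by simp
    ultimately have "sqrt (h\<^sup>2 * (I2 / l ^ CARD('n))) \<le> L2_norm v"
      unfolding L2_norm_def by simp
    moreover have "sqrt (h\<^sup>2 * (I2 / l ^ CARD('n))) = c1 / real N ^ m"
    proof -
      have "sqrt (h\<^sup>2 * (I2 / l ^ CARD('n))) = h * sqrt (I2 / l ^ CARD('n))"
        unfolding real_sqrt_mult using h(1) by simp
      then show ?thesis
        by (simp add: c1_def h_def power_mult_distrib mult_ac)
    qed
    ultimately show ?thesis by simp
  qed
  moreover have "c * real N powr (- \<mu>) < c1 / real N ^ m"
  proof -
    have "c < c1 * real N powr (\<mu> - real m)"
      using N(1) \<open>0 < c1\<close> by (simp add: divide_less_eq mult.commute)
    then have "c * real N powr (- \<mu>) < c1 * real N powr (\<mu> - real m) * real N powr (- \<mu>)"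
      using N(3) by (intro mult_strict_right_mono) auto
    also have "\<dots> = c1 * real N powr (- real m)"
      by (simp add: mult.assoc powr_add[symmetric])
    finally show ?thesis
      using N(3) by (simp add: powr_minus powr_realpow divide_inverse)
  qed
  ultimately have "c * log_modulus \<mu> (enn2real (Linf_norm B (fourier v))) < L2_norm v"
    using mult_left_mono[OF log, of c] assms(9) by linarith
  then show ?thesis
    using supp Cm norm Linf1 by blast
qed

end
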